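(* Let $\lambda\in\mathbb{D}$ and $z_0\in\mathbb{D}\setminus\{0\}$. Then the boundary $\partial V_{\mathcal{R}}(z_0,\lambda)$ is the Jordan curve given by $$(-\pi,\pi]\ni\theta\mapsto H_{e^{i\theta},\lambda}(z_0)=z_0+2(1-\beta)\int_0^{z_0}\frac{(e^{i\theta}\zeta+\lambda)\zeta}{1+\overline{\lambda}e^{i\theta}\zeta-(e^{i\theta}\zeta+\lambda)\zeta}\,d\zeta .$$ Moreover, if $f(z_0)=H_{e^{i\theta},\lambda}(z_0)$ for some $f\in\mathcal{R}(\lambda)$ and some $\theta\in(-\pi,\pi]$, then $f(z)=H_{e^{i\theta},\lambda}(z)$ for all $z\in\mathbb{D}$.
   Context: $\mathbb{D}=\{z\in\mathbb{C}:|z|<1\}$, and $\mathcal{A}$ is the class of analytic functions $f$ on $\mathbb{D}$ with $f(0)=0=f'(0)-1$. Fix a real number $\beta$ with $0\le\beta<1$ and let $\mathcal{R}_\beta=\{f\in\mathcal{A}:\ \mathrm{Re}\,f'(z)>\beta\text{ in }\mathbb{D}\}$. For $\lambda\in\overline{\mathbb{D}}$ and $z_0\in\mathbb{D}$ set $$\mathcal{R}(\lambda)=\{f\in\mathcal{R}_\beta:\ f''(0)=2(1-\beta)\lambda\},\qquad V_{\mathcal{R}}(z_0,\lambda)=\{f(z_0):\ f\in\mathcal{R}(\lambda)\}.$$ For $\lambda\in\mathbb{D}$ and $\theta\in\mathbb{R}$ set $$H_{e^{i\theta},\lambda}(z)=z+2(1-\beta)\int_0^{z}\frac{(e^{i\theta}\zeta+\lambda)\zeta}{1+\overline{\lambda}e^{i\theta}\zeta-(e^{i\theta}\zeta+\lambda)\zeta}\,d\zeta,\quad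 z\in\mathbb{D}.$$ A Jordan curve is a simple closed curve. *)

theory Defs
  imports "HOL-Complex_Analysis.Complex_Analysis"
begin

text \<open>
  Functions on the unit disc are total functions of type \<open>complex \<Rightarrow> complex\<close>; their values
  outside \<open>ball 0 1\<close> are irrelevant, since every condition below only concerns their
  restriction to the disc.
\<close>

definition class_A :: "(complex \<Rightarrow> complex) set" where
  "class_A = {f. f holomorphic_on ball 0 1 \<and> f 0 = 0 \<and> deriv f 0 - 1 = 0}"

definition class_R :: "real \<Rightarrow> (complex \<Rightarrow> complex) set" where
  "class_R \<beta> = {f \<in> class_A. \<forall>z\<in>ball 0 1. Re (deriv f z) > \<beta>}"

definition class_R_at :: "real \<Rightarrow> complex \<Rightarrow> (complex \<Rightarrow> complex) set" where
  "class_R_at \<beta> lam = {f \<in> class_R \<beta>. deriv (deriv f) 0 = 2 * (1 - of_real \<beta>) * lam}"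

definition V_R :: "real \<Rightarrow> complex \<Rightarrow> complex \<Rightarrow> complex set" where
  "V_R \<beta> z\<^sub>0 lam = {f z\<^sub>0 | f. f \<in> class_R_at \<beta> lam}"

text \<open>
  The integrand is holomorphic on the unit disc when \<open>norm w = 1\<close> and \<open>norm lam < 1\<close>, so the
  integral from \<open>0\<close> to \<open>z\<close> does not depend on the path in the disc; it is taken along the
  segment.
\<close>

definition H :: "real \<Rightarrow> complex \<Rightarrow> complex \<Rightarrow> complex \<Rightarrow> complex" where
  "H \<beta> w lam z = z + 2 * (1 - of_real \<beta>) *
     contour_integral (linepath 0 z)
       (\<lambda>\<zeta>. ((w * \<zeta> + lam) * \<zeta>) / (1 + cnj lam * w * \<zeta> - (w * \<zeta> + lam) * \<zeta>))"

text \<open>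
  The curve \<open>\<theta> \<mapsto> c \<theta>\<close> on the half-open interval \<open>(-\<pi>, \<pi>]\<close> is a Jordan curve: rescaled to the
  library's parameter interval \<open>[0, 1]\<close>, it is a simple closed path.
\<close>

definition Jordan_param :: "(real \<Rightarrow> complex) \<Rightarrow> bool" where
  "Jordan_param c \<longleftrightarrow>
     simple_path (c \<circ> linepath (- pi) pi) \<and>
     pathfinish (c \<circ> linepath (- pi) pi) = pathstart (c \<circ> linepath (- pi) pi)"

end

theory Submission
  imports Defs
begin

text \<open>
  Every \<open>f\<close> in the class has the form \<open>f' = 1 + 2(1 - \<beta>) \<omega> / (1 - \<omega>)\<close> with a Schwarz function
  \<open>\<omega>\<close> satisfying \<open>\<omega>'(0) = lam\<close>. Two applications of Schwarz's lemma write \<open>\<omega>\<close> in terms of a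
  holomorphic \<open>\<sigma>\<close> with \<open>\<bar>\<sigma>\<bar> \<le> 1\<close>, and the functions \<open>H\<close> are those whose \<open>\<sigma>\<close> is a unimodular constant
  \<open>w\<close> (\<open>class_R_at_representation\<close>). A Moebius computation gives, with a positive constant \<open>c\<close>,

    \<open>H' - f' = c w z\<^sup>2 K q\<close>, where \<open>K = 1 / (1 + (cnj lam w - lam) z - w z\<^sup>2)\<^sup>2\<close>

  depends on \<open>w\<close> and \<open>lam\<close> alone, and where \<open>Re q > 0\<close> on the disc as soon as \<open>\<sigma>\<close> is not the
  constant \<open>w\<close>.

  The heart of the proof is that a positive real part survives integration against \<open>z\<^sup>2 K\<close>:
  writing \<open>\<integral> z\<^sup>2 K = z\<^sup>3 g\<close> and \<open>\<integral> z\<^sup>2 K q = z\<^sup>3 n\<close>, one has \<open>Re (n / g) > 0\<close>. This is the classical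
  lemma on quotients of integrals (\<open>Re_quotient_of_integrals_pos\<close>). It requires \<open>z\<^sup>3 g\<close> to be starlike
  (with multiplicity three), which follows from its convexity (\<open>convex_imp_starlike\<close>); the convexity is
  an explicit inequality (\<open>Re_convexity_factor_pos\<close>). Both implications come from looking at
  the first point, in order of modulus, where a real part vanishes
  (\<open>first_zero_of_real_part\<close>).

  Hence \<open>Re ((H z\<^sub>0 - f z\<^sub>0) / e) > 0\<close> for \<open>e = w z\<^sub>0\<^sup>3 g(z\<^sub>0)\<close> and every \<open>f \<noteq> H\<close> in the class: \<open>H z\<^sub>0\<close> is a
  strictly exposed point of the region of variability, attained only by \<open>H\<close>
  (\<open>H_strictly_exposed\<close>). This settles uniqueness, shows that the parametrised curve is simple, and
  places it in the boundary. Conversely, the region is convex and a simple closed curve that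
  runs in a convex plane set \<open>V\<close> and misses its interior is the whole boundary: otherwise a segment
  from a point inside the curve to a further boundary point would meet the curve in an interior point
  of \<open>V\<close> (\<open>frontier_convex_eq_Jordan_curve\<close>).
\<close>

section \<open>Division by powers of the variable\<close>

lemma cancel_identity_factor:
  assumes F: "F holomorphic_on ball 0 1" and G: "G holomorphic_on ball 0 1"
    and eq: "\<And>z. z \<in> ball 0 1 \<Longrightarrow> z * F z = z * (G z :: complex)"
    and z: "z \<in> ball 0 1"
  shows "F z = G z"
proof (cases "z = 0")
  case False
  then show ?thesis using eq[OF z] by simp
next
  case True
  have "((\<lambda>z. F z) \<longlongrightarrow> F 0) (at 0)" "((\<lambda>z. G z) \<longlongrightarrow> G 0) (at 0)"
    using F G by (auto dest!: holomorphic_on_imp_continuous_on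
        simp: continuous_on_eq_continuous_at isCont_def)
  moreover have "eventually (\<lambda>z. z \<in> ball 0 1 - {0}) (at (0::complex))"
    by (rule eventually_at_in_open) auto
  then have "eventually (\<lambda>z. F z = G z) (at 0)"
    by eventually_elim (use eq in auto)
  then have "((\<lambda>z. F z) \<longlongrightarrow> G 0) (at 0)"
    using \<open>((\<lambda>z. G z) \<longlongrightarrow> G 0) (at 0)\<close> tendsto_cong by blast
  ultimately show ?thesis
    using True tendsto_unique[of "at (0::complex)"] by auto
qed

text \<open>
  This replaces division by powers of \<open>z\<close>: for a solution \<open>g\<close>, the derivative of \<open>z ^ (m + 1) * g\<close> is \<open>z ^ m * F\<close>, so
  \<open>g\<close> is the primitive of \<open>z ^ m * F\<close> freed from its zero at the origin. In the induction step the
  equation for \<open>z F\<close> forces its solution to vanish at \<open>0\<close>, and the quotient of that solution by \<open>z\<close> is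
  the next one.
\<close>

lemma Euler_equation_solvable:
  assumes "F holomorphic_on ball 0 1"
  shows "\<exists>g. g holomorphic_on ball 0 1 \<and>
             (\<forall>z\<in>ball 0 1. z * deriv g z + of_nat (Suc m) * g z = F z)"
  using assms
proof (induction m arbitrary: F)
  case 0
  obtain G where G: "\<And>z. z \<in> ball 0 1 \<Longrightarrow> (G has_field_derivative F z) (at z within ball 0 1)"
    by (rule holomorphic_convex_primitive'[OF convex_ball open_ball 0]) iprover
  define G0 where "G0 z = G z - G 0" for z
  have G0: "(G0 has_field_derivative F z) (at z)" if "z \<in> ball 0 1" for z
  proof -
    have "(G has_field_derivative F z) (at z)"
      using G[OF that] unfolding at_within_open[OF that open_ball] .
    then show ?thesis unfolding G0_def by (auto intro!: derivative_eq_intros)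
  qed
  then have "G0 holomorphic_on ball 0 1"
    unfolding holomorphic_on_open[OF open_ball] by blast
  then obtain g where g: "g holomorphic_on ball 0 1" "\<And>z. norm z < 1 \<Longrightarrow> G0 z = z * g z"
    by (rule Schwarz3) (auto simp: G0_def)
  have "z * deriv g z + g z = F z" if z: "z \<in> ball 0 1" for z
  proof -
    have "((\<lambda>z. z * g z) has_field_derivative g z + z * deriv g z) (at z)"
      using holomorphic_derivI[OF g(1) open_ball z] by (auto intro!: derivative_eq_intros)
    moreover have "((\<lambda>z. z * g z) has_field_derivative F z) (at z)"
      by (rule has_field_derivative_transform_within_open[OF G0[OF z] open_ball z])
        (use g(2) in auto)
    ultimately show ?thesis using DERIV_unique by (metis add.commute)
  qed
  with g show ?case by auto
next
  case (Suc m)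
  have "(\<lambda>z. z * F z) holomorphic_on ball 0 1"
    using Suc.prems by (intro holomorphic_intros)
  then obtain h where h: "h holomorphic_on ball 0 1"
    "\<And>z. z \<in> ball 0 1 \<Longrightarrow> z * deriv h z + of_nat (Suc m) * h z = z * F z"
    using Suc.IH by blast
  have "of_nat (Suc m) * h 0 = 0" using h(2)[of 0] by simp
  then have "h 0 = 0" using of_nat_neq_0 mult_eq_0_iff by blast
  with h(1) obtain g where g: "g holomorphic_on ball 0 1" "\<And>z. norm z < 1 \<Longrightarrow> h z = z * g z"
    by (rule Schwarz3) iprover
  have dh: "deriv h z = g z + z * deriv g z" if z: "z \<in> ball 0 1" for z
  proof -
    have "((\<lambda>z. z * g z) has_field_derivative g z + z * deriv g z) (at z)"
      using holomorphic_derivI[OF g(1) open_ball z] by (auto intro!: derivative_eq_intros)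
    then have "(h has_field_derivative g z + z * deriv g z) (at z)"
      by (rule has_field_derivative_transform_within_open[OF _ open_ball z]) (use g(2) in auto)
    then show ?thesis by (rule DERIV_imp_deriv)
  qed
  have "z * deriv g z + of_nat (Suc (Suc m)) * g z = F z" if z: "z \<in> ball 0 1" for z
  proof (rule cancel_identity_factor[OF _ Suc.prems _ z])
    show "(\<lambda>z. z * deriv g z + of_nat (Suc (Suc m)) * g z) holomorphic_on ball 0 1"
      using g(1) by (intro holomorphic_intros) auto
    show "z * (z * deriv g z + of_nat (Suc (Suc m)) * g z) = z * F z" if "z \<in> ball 0 1" for z
      using h(2)[OF that] dh[OF that] g(2)[of z] that by (simp add: algebra_simps)
  qed
  with g show ?case by blast
qed

section \<open>Positive real parts\<close>

text \<open>
  Take \<open>z\<close> of least modulus with \<open>Re (P z) \<le> 0\<close>. The real part of \<open>P\<close> is minimal at \<open>z\<close> along the circle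
  through \<open>z\<close>, so its tangential derivative \<open>Re (\<i> z P'(z))\<close> vanishes; it is positive along the radius
  up to \<open>z\<close>, so the radial derivative \<open>Re (z P'(z))\<close> is not positive. This is the half-plane form of
  Jack's lemma.
\<close>

lemma first_zero_of_real_part:
  assumes P: "P holomorphic_on ball 0 1" and P0: "Re (P 0) > 0"
    and ex: "z1 \<in> ball 0 1" "Re (P z1) \<le> 0"
  obtains z where "z \<in> ball 0 1" "Re (P z) = 0" "Im (z * deriv P z) = 0" "Re (z * deriv P z) \<le> 0"
proof -
  have contP: "continuous_on (ball 0 1) P"
    using P by (rule holomorphic_on_imp_continuous_on)
  define S where "S = {z \<in> cball 0 (norm z1). Re (P z) \<le> 0}"
  have sub: "cball 0 (norm z1) \<subseteq> ball (0::complex) 1" using ex by auto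
  have "continuous_on (cball 0 (norm z1)) (\<lambda>z. Re (P z))"
    using continuous_on_subset[OF contP sub] by (intro continuous_intros)
  then have "closedin (top_of_set (cball 0 (norm z1)))
               (cball 0 (norm z1) \<inter> (\<lambda>z. Re (P z)) -` {..0})"
    by (rule continuous_closedin_preimage) auto
  then have "compact (cball 0 (norm z1) \<inter> (\<lambda>z. Re (P z)) -` {..0})"
    by (rule closedin_compact[rotated]) auto
  then have "compact S" by (simp add: S_def vimage_def Int_def)
  moreover have "S \<noteq> {}" using ex by (auto simp: S_def)
  ultimately obtain w where w: "w \<in> S" "\<And>v. v \<in> S \<Longrightarrow> norm w \<le> norm v"
    using continuous_attains_inf[of S norm] continuous_on_norm_id by blast
  have w1: "w \<in> ball 0 1" using w(1) sub by (auto simp: S_def)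
  have "w \<noteq> 0" using w(1) P0 by (auto simp: S_def)
  have pos: "Re (P v) > 0" if "norm v < norm w" for v
  proof -
    have "v \<notin> S" using w(2)[of v] that by auto
    then show ?thesis using w(1) that by (auto simp: S_def)
  qed
  have dP: "(P has_field_derivative deriv P w) (at w)"
    by (rule holomorphic_derivI[OF P open_ball w1])
  have circ: "Re (P v) \<ge> 0" if v: "norm v = norm w" for v
  proof -
    have "isCont P v"
      using contP w1 v by (simp add: continuous_on_eq_continuous_at)
    then have "isCont P ((\<lambda>t. of_real t * v) (1::real))" by simp
    moreover have "isCont (\<lambda>t. of_real t * v) (1::real)" by (intro continuous_intros)
    ultimately have "isCont (\<lambda>t. P (of_real t * v)) 1" by (rule isCont_o2[rotated])
    then have "isCont (\<lambda>t. Re (P (of_real t * v))) 1" by (rule isCont_Re)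
    then have "((\<lambda>t. Re (P (of_real t * v))) \<longlongrightarrow> Re (P (of_real 1 * v))) (at_left 1)"
      unfolding isCont_def by (rule filterlim_mono) (auto intro: at_le)
    moreover have "eventually (\<lambda>t. t \<in> {0<..<1}) (at_left (1::real))"
      by (rule eventually_at_leftI[of 0]) auto
    then have "eventually (\<lambda>t. 0 \<le> Re (P (of_real t * v))) (at_left 1)"
    proof eventually_elim
      case (elim t)
      then show ?case using \<open>w \<noteq> 0\<close> v
        by (intro less_imp_le pos) (auto simp: norm_mult)
    qed
    ultimately show ?thesis
      by (metis mult_1 of_real_1 tendsto_lowerbound trivial_limit_at_left_real)
  qed
  have Pw: "Re (P w) = 0" using circ[of w] w(1) by (auto simp: S_def)
  have "((\<lambda>t. P (of_real t * w)) has_vector_derivative (w * deriv P w)) (at 1)"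
  proof (rule has_vector_derivative_real_field)
    have "((\<lambda>z. z * w) has_field_derivative w) (at (of_real 1))"
      by (auto intro!: derivative_eq_intros)
    moreover have "(P has_field_derivative deriv P w) (at (of_real 1 * w))" using dP by simp
    ultimately show "((\<lambda>z. P (z * w)) has_field_derivative w * deriv P w) (at (of_real 1))"
      using DERIV_chain2 by (metis mult.commute)
  qed
  then have rad: "((\<lambda>t. Re (P (of_real t * w))) has_real_derivative Re (w * deriv P w)) (at 1)"
    by (simp add: has_vector_derivative_complex_iff)
  have "((\<lambda>t. P (cis t * w)) has_vector_derivative (\<i> * w * deriv P w)) (at 0)"
  proof -
    have "((\<lambda>z. exp (\<i> * z) * w) has_field_derivative \<i> * w) (at (of_real 0))"
      by (auto intro!: derivative_eq_intros)
    moreover have "(P has_field_derivative deriv P w) (at (exp (\<i> * of_real 0) * w))"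
      using dP by simp
    ultimately have "((\<lambda>z. P (exp (\<i> * z) * w)) has_field_derivative \<i> * w * deriv P w)
        (at (of_real 0))"
      using DERIV_chain2[of P] by (metis mult.commute)
    then have "((\<lambda>t. P (exp (\<i> * of_real t) * w)) has_vector_derivative (\<i> * w * deriv P w)) (at 0)"
      by (rule has_vector_derivative_real_field)
    then show ?thesis by (simp add: cis_conv_exp)
  qed
  then have ang: "((\<lambda>t. Re (P (cis t * w))) has_real_derivative Re (\<i> * w * deriv P w)) (at 0)"
    by (simp add: has_vector_derivative_complex_iff)
  have "Re (\<i> * w * deriv P w) = 0"
    by (rule DERIV_local_min[OF ang, of 1]) (use circ Pw in \<open>auto simp: norm_mult\<close>)
  moreover have "\<not> Re (w * deriv P w) > 0"
  proof
    assume "Re (w * deriv P w) > 0"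
    from DERIV_pos_inc_left[OF rad this] obtain d where d: "d > 0"
      "\<And>h. h > 0 \<Longrightarrow> h < d \<Longrightarrow> Re (P (of_real (1 - h) * w)) < Re (P (of_real 1 * w))"
      by blast
    define h where "h = min (d/2) (1/2)"
    have h: "h > 0" "h < d" "h < 1" using d(1) by (auto simp: h_def)
    have "Re (P (of_real (1 - h) * w)) < 0" using d(2)[OF h(1,2)] Pw by simp
    moreover have "Re (P (of_real (1 - h) * w)) > 0"
      using h \<open>w \<noteq> 0\<close> by (intro pos) (simp add: norm_mult del: of_real_diff)
    ultimately show False by simp
  qed
  ultimately show thesis
    using that[OF w1 Pw] by (simp add: mult.assoc)
qed

text \<open>
  In terms of \<open>G = z ^ m * g\<close>, whose derivative is \<open>z ^ (m - 1) * K\<close>, the hypothesis says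
  \<open>Re (1 + z G'' / G') > 0\<close> and the conclusion says \<open>Re (z G' / G) > 0\<close>. The quotient \<open>P = g / K\<close> satisfies
  \<open>P (m + z K' / K) = 1 - z P'\<close>. At a first zero of \<open>Re P\<close> the right-hand side is a real number
  \<open>\<ge> 1\<close> while \<open>P\<close> is imaginary, so \<open>m + z K' / K\<close> would be imaginary as well. Working with
  \<open>g / K\<close> instead of \<open>z G' / G\<close> spares a separate proof that \<open>g\<close> has no zeros.
\<close>

lemma convex_imp_starlike:
  fixes K g :: "complex \<Rightarrow> complex"
  assumes K: "K holomorphic_on ball 0 1" and K_nz: "\<And>z. z \<in> ball 0 1 \<Longrightarrow> K z \<noteq> 0"
    and g: "g holomorphic_on ball 0 1" and m: "m > 0"
    and g_eq: "\<And>z. z \<in> ball 0 1 \<Longrightarrow> z * deriv g z + of_nat m * g z = K z"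
    and conv: "\<And>z. z \<in> ball 0 1 \<Longrightarrow> Re (of_nat m + z * deriv K z / K z) > 0"
    and z: "z \<in> ball 0 1"
  shows "Re (g z / K z) > 0"
proof (rule ccontr)
  assume neg: "\<not> ?thesis"
  define P where "P z = g z / K z" for z
  have P: "P holomorphic_on ball 0 1"
    unfolding P_def using K g K_nz by (intro holomorphic_intros) auto
  have "of_nat m * g 0 = K 0" using g_eq[of 0] by simp
  then have "P 0 = 1 / of_nat m" using K_nz[of 0] m by (auto simp: P_def field_simps)
  then have "P 0 = of_real (1 / real m)" by simp
  then have "Re (P 0) > 0" using m by (simp del: of_real_divide)
  then obtain u where u: "u \<in> ball 0 1" "Re (P u) = 0" "Im (u * deriv P u) = 0"
    "Re (u * deriv P u) \<le> 0"
    using first_zero_of_real_part[OF P _ z] neg P_def by force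
  define Q where "Q = of_nat m + u * deriv K u / K u"
  have "(P has_field_derivative (deriv g u * K u - g u * deriv K u) / (K u * K u)) (at u)"
    unfolding P_def
    using holomorphic_derivI[OF g open_ball u(1)] holomorphic_derivI[OF K open_ball u(1)]
      K_nz[OF u(1)] by (auto intro!: DERIV_divide)
  then have dP: "deriv P u = (deriv g u * K u - g u * deriv K u) / (K u * K u)"
    by (rule DERIV_imp_deriv)
  have "u * deriv P u = (u * deriv g u) / K u - P u * (u * deriv K u / K u)"
    unfolding dP using K_nz[OF u(1)] by (simp add: P_def field_simps)
  also have "u * deriv g u = K u - of_nat m * g u" using g_eq[OF u(1)] by (simp add: algebra_simps)
  also have "(K u - of_nat m * g u) / K u = 1 - of_nat m * P u"
    using K_nz[OF u(1)] by (simp add: P_def diff_divide_distrib)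
  finally have "P u * Q = 1 - u * deriv P u"
    by (simp add: Q_def distrib_left mult.commute)
  then have "Re (P u * Q) \<ge> 1" "Im (P u * Q) = 0" using u by auto
  then have "Re Q = 0" using u(2) by auto
  then show False using conv[OF u(1)] by (simp add: Q_def)
qed

text \<open>
  The quotient \<open>P = n / g\<close> satisfies \<open>q = P + z P' (g / K)\<close>. At a first zero of \<open>Re P\<close> the number \<open>z P'\<close> is
  real and \<open>\<le> 0\<close>, and starlikeness \<open>Re (g / K) > 0\<close> then gives \<open>Re q \<le> 0\<close>.
\<close>

lemma Re_quotient_of_integrals_pos:
  fixes K g n q :: "complex \<Rightarrow> complex"
  assumes g: "g holomorphic_on ball 0 1" and n: "n holomorphic_on ball 0 1"
    and m: "m > 0"
    and g_eq: "\<And>z. z \<in> ball 0 1 \<Longrightarrow> z * deriv g z + of_nat m * g z = K z"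
    and n_eq: "\<And>z. z \<in> ball 0 1 \<Longrightarrow> z * deriv n z + of_nat m * n z = K z * q z"
    and star: "\<And>z. z \<in> ball 0 1 \<Longrightarrow> Re (g z / K z) > 0"
    and q: "\<And>z. z \<in> ball 0 1 \<Longrightarrow> Re (q z) > 0"
    and z: "z \<in> ball 0 1"
  shows "Re (n z / g z) > 0"
proof (rule ccontr)
  assume neg: "\<not> ?thesis"
  have nz: "g z \<noteq> 0" "K z \<noteq> 0" if "z \<in> ball 0 1" for z
    using star[OF that] by auto
  define P where "P z = n z / g z" for z
  have P: "P holomorphic_on ball 0 1"
    unfolding P_def using n g nz by (intro holomorphic_intros) auto
  have "of_nat m * g 0 = K 0" "of_nat m * n 0 = K 0 * q 0"
    using g_eq[of 0] n_eq[of 0] by simp_all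
  then have "of_nat m * n 0 = of_nat m * (g 0 * q 0)" by (simp add: mult.assoc)
  then have "P 0 = q 0" using nz[of 0] m by (auto simp: P_def field_simps)
  then have "Re (P 0) > 0" using q[of 0] by simp
  then obtain u where u: "u \<in> ball 0 1" "Re (P u) = 0" "Im (u * deriv P u) = 0"
    "Re (u * deriv P u) \<le> 0"
    using first_zero_of_real_part[OF P _ z] neg P_def by force
  have "(P has_field_derivative (deriv n u * g u - n u * deriv g u) / (g u * g u)) (at u)"
    unfolding P_def
    using holomorphic_derivI[OF n open_ball u(1)] holomorphic_derivI[OF g open_ball u(1)]
      nz[OF u(1)] by (auto intro!: DERIV_divide)
  then have dP: "deriv P u = (deriv n u * g u - n u * deriv g u) / (g u * g u)"
    by (rule DERIV_imp_deriv)
  have "u * deriv P u * g u = u * deriv n u - P u * (u * deriv g u)"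
    unfolding dP using nz[OF u(1)] by (simp add: P_def field_simps)
  also have "\<dots> = K u * q u - of_nat m * n u - P u * (K u - of_nat m * g u)"
    using n_eq[OF u(1)] g_eq[OF u(1)] by (simp only: eq_diff_eq[symmetric])
  also have "\<dots> = K u * q u - P u * K u"
    using nz[OF u(1)] by (simp add: P_def field_simps)
  finally have "q u = P u + u * deriv P u * (g u / K u)"
    using nz[OF u(1)] by (simp add: field_simps)
  then have "Re (q u) = Re (P u) + Re ((u * deriv P u) * (g u / K u))" by simp
  also have "\<dots> = Re (u * deriv P u) * Re (g u / K u)"
    unfolding times_complex.simps(1)[of "u * deriv P u"] u(2,3) by simp
  also have "\<dots> \<le> 0" using u(4) star[OF u(1)] by (simp add: mult_nonpos_nonneg)
  finally show False using q[OF u(1)] by simp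
qed

lemma Re_Cayley:
  fixes a b :: complex
  assumes "a \<noteq> b"
  shows "Re ((a + b) / (a - b)) = ((norm a)\<^sup>2 - (norm b)\<^sup>2) / (norm (a - b))\<^sup>2"
proof -
  have "Re ((a + b) * cnj (a - b)) = (norm a)\<^sup>2 - (norm b)\<^sup>2"
    unfolding cmod_power2 by (simp add: algebra_simps power2_eq_square)
  then show ?thesis
    by (subst complex_div_cnj) (simp add: Re_divide_of_real del: complex_cnj_diff of_real_power
      flip: of_real_power)
qed

lemma Re_Cayley_pos: "norm b < norm a \<Longrightarrow> Re ((a + b) / (a - b)) > 0"
  for a b :: complex
  using Re_Cayley[of a b] by (cases "a = b") (auto simp: power_strict_mono zero_less_divide_iff)

lemma Re_Cayley_nonneg: "norm b \<le> norm a \<Longrightarrow> Re ((a + b) / (a - b)) \<ge> 0"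
  for a b :: complex
  using Re_Cayley[of a b] by (cases "a = b") (auto simp: power_mono)

section \<open>Schwarz functions\<close>

lemma norm_add_less_Moebius:
  fixes a b :: complex
  assumes "norm a < 1" "norm b < 1"
  shows "norm (a + b) < norm (1 + cnj b * a)"
proof -
  have "(norm (1 + cnj b * a))\<^sup>2 - (norm (a + b))\<^sup>2 = (1 - (norm a)\<^sup>2) * (1 - (norm b)\<^sup>2)"
    unfolding cmod_power2 by (simp add: algebra_simps power2_eq_square)
  also have "\<dots> > 0"
    using assms by (intro mult_pos_pos) (auto simp: power_less_one_iff abs_square_less_1)
  finally show ?thesis by (simp add: power2_less_imp_less)
qed

text \<open>
  The alternative in the last conclusion is what makes uniqueness work: a quotient that takes a
  unimodular value anywhere is constant.
\<close>

lemma Schwarz_quotient: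
  assumes F: "F holomorphic_on ball 0 1" "F 0 = 0" and bd: "\<And>z. norm z < 1 \<Longrightarrow> norm (F z) < 1"
  obtains \<sigma> where "\<sigma> holomorphic_on ball 0 1" "\<And>z. norm z < 1 \<Longrightarrow> F z = z * \<sigma> z"
    "\<sigma> 0 = deriv F 0"
    "(\<forall>z\<in>ball 0 1. norm (\<sigma> z) < 1) \<or> (\<exists>\<alpha>. norm \<alpha> = 1 \<and> (\<forall>z\<in>ball 0 1. \<sigma> z = \<alpha>))"
proof -
  obtain \<sigma> where \<sigma>: "\<sigma> holomorphic_on ball 0 1" "\<And>z. norm z < 1 \<Longrightarrow> F z = z * \<sigma> z"
    "deriv F 0 = \<sigma> 0"
    using Schwarz3[OF F] by metis
  have "(\<forall>z\<in>ball 0 1. norm (\<sigma> z) < 1) \<or> (\<exists>\<alpha>. norm \<alpha> = 1 \<and> (\<forall>z\<in>ball 0 1. \<sigma> z = \<alpha>))"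
  proof (cases "(\<exists>z. norm z < 1 \<and> z \<noteq> 0 \<and> norm (F z) = norm z) \<or> norm (deriv F 0) = 1")
    case True
    obtain \<alpha> where \<alpha>: "\<And>z. norm z < 1 \<Longrightarrow> F z = \<alpha> * z" "norm \<alpha> = 1"
      using Schwarz_Lemma(3)[OF F bd _ True, of 0] by auto
    have "\<sigma> z = \<alpha>" if "z \<in> ball 0 1" for z
    proof (rule cancel_identity_factor[OF \<sigma>(1) holomorphic_on_const _ that])
      fix v :: complex assume "v \<in> ball 0 1"
      then have "v * \<sigma> v = \<alpha> * v" using \<sigma>(2)[of v] \<alpha>(1)[of v] by auto
      then show "v * \<sigma> v = v * \<alpha>" by (simp only: mult.commute)
    qed
    with \<alpha>(2) show ?thesis by blast
  next
    case False
    have "norm (\<sigma> z) < 1" if z: "norm z < 1" for z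
    proof (cases "z = 0")
      case True
      then show ?thesis
        using Schwarz_Lemma(2)[OF F bd, of 0] False unfolding \<sigma>(3) by simp
    next
      case z0: False
      have "norm (F z) < norm z"
        using Schwarz_Lemma(1)[OF F bd z] False z z0 by (metis order_le_imp_less_or_eq)
      then show ?thesis using \<sigma>(2)[OF z] z0 by (simp add: norm_mult)
    qed
    then show ?thesis by auto
  qed
  then show thesis using that \<sigma> by metis
qed

section \<open>The derivative of a function in the class\<close>

text \<open>
  With \<open>\<omega> = z (s z + lam) / (1 + cnj lam s z)\<close>, the Schwarz function of parameter \<open>s\<close>,
  \<open>deriv_kernel\<close> is \<open>\<omega> / (1 - \<omega>)\<close> with the inner fraction cleared, and \<open>deriv_kernel_den\<close> is its
  denominator.
\<close>

definition deriv_kernel_den :: "complex \<Rightarrow> complex \<Rightarrow> complex \<Rightarrow> complex" where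
  "deriv_kernel_den lam s z = 1 + cnj lam * s * z - (s * z + lam) * z"

definition deriv_kernel :: "complex \<Rightarrow> complex \<Rightarrow> complex \<Rightarrow> complex" where
  "deriv_kernel lam s z = (s * z + lam) * z / deriv_kernel_den lam s z"

lemma deriv_kernel_den_eq: "deriv_kernel_den lam s z = (1 - lam * z) + s * (z * (cnj lam - z))"
  by (simp add: deriv_kernel_den_def algebra_simps)

lemma norm_deriv_kernel_numerator_less:
  assumes "norm lam < 1" "norm s \<le> 1" "norm z < 1"
  shows "norm ((s * z + lam) * z) < norm (1 + cnj lam * s * z)"
proof -
  have "norm (s * z) < 1"
    using assms mult_left_le_one_le[of "norm z" "norm s"] by (simp add: norm_mult)
  then have "norm (s * z + lam) < norm (1 + cnj lam * (s * z))"
    using assms(1) by (rule norm_add_less_Moebius)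
  moreover have "norm ((s * z + lam) * z) \<le> norm (s * z + lam)"
    using assms(3) by (simp add: norm_mult mult_left_le)
  ultimately show ?thesis by (simp add: mult.assoc)
qed

lemma deriv_kernel_den_nonzero:
  assumes "norm lam < 1" "norm s \<le> 1" "norm z < 1"
  shows "deriv_kernel_den lam s z \<noteq> 0"
  using norm_deriv_kernel_numerator_less[OF assms] by (auto simp: deriv_kernel_den_def)

lemma Re_deriv_kernel_gt:
  assumes "norm lam < 1" "norm s \<le> 1" "norm z < 1"
  shows "Re (deriv_kernel lam s z) > - 1 / 2"
proof -
  define x y where "x = (s * z + lam) * z" and "y = 1 + cnj lam * s * z"
  have xy: "norm x < norm y"
    unfolding x_def y_def by (rule norm_deriv_kernel_numerator_less[OF assms])
  then have "y \<noteq> x" by auto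
  then have "(y + x) / (y - x) = 2 * deriv_kernel lam s z + 1"
    by (simp add: deriv_kernel_def deriv_kernel_den_def flip: x_def y_def) (simp add: field_simps)
  then have "Re (2 * deriv_kernel lam s z + 1) > 0" using Re_Cayley_pos[OF xy] by simp
  then show ?thesis by simp
qed

lemma deriv_kernel_diff:
  assumes "norm lam < 1" "norm s \<le> 1" "norm w \<le> 1" "norm z < 1"
  shows "deriv_kernel lam w z - deriv_kernel lam s z
     = of_real (1 - (norm lam)\<^sup>2) * (w - s) * z\<^sup>2 / (deriv_kernel_den lam w z * deriv_kernel_den lam s z)"
proof -
  have nz: "deriv_kernel_den lam w z \<noteq> 0" "deriv_kernel_den lam s z \<noteq> 0"
    using deriv_kernel_den_nonzero assms by auto
  have key: "(w * z + lam) * z * deriv_kernel_den lam s z - (s * z + lam) * z * deriv_kernel_den lam w z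
      = (1 - lam * cnj lam) * (w - s) * z\<^sup>2"
    by (simp add: deriv_kernel_den_def algebra_simps power2_eq_square)
  have "1 - lam * cnj lam = of_real (1 - (norm lam)\<^sup>2)"
    unfolding of_real_diff complex_norm_square by simp
  with key show ?thesis
    unfolding deriv_kernel_def diff_frac_eq[OF nz] by simp
qed

text \<open>
  By \<open>deriv_kernel_diff\<close>, this factor is the only part of the difference of two kernels that
  depends on \<open>s\<close>. For \<open>z\<close> fixed it is a Moebius function of \<open>s\<close> vanishing at \<open>w\<close>, and it maps the unit disc to a
  disc that touches the imaginary axis at \<open>0\<close> from the right. The proof sees this from its
  reciprocal, which is a sum of two Cayley transforms.
\<close>

lemma Re_angle_factor_pos:
  assumes lam: "norm lam < 1" and s: "norm s \<le> 1" and w: "norm w = 1" "s \<noteq> w" and z: "norm z < 1"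
  shows "Re (deriv_kernel_den lam w z / deriv_kernel_den lam s z * (1 - s / w)) > 0"
proof -
  define A x where "A = 1 - lam * z" and "x = z * (cnj lam - z)"
  have "norm (z + - cnj lam) < norm (1 + cnj (- cnj lam) * z)"
    using z lam by (intro norm_add_less_Moebius) auto
  moreover have "norm x \<le> norm (z - cnj lam)"
    using z by (simp add: x_def norm_mult mult_left_le_one_le norm_minus_commute)
  ultimately have xA: "norm (w * x) < norm A"
    using w by (simp add: A_def norm_mult)
  have D: "deriv_kernel_den lam w z = A + w * x" "deriv_kernel_den lam s z = A + s * x"
    by (simp_all add: deriv_kernel_den_eq A_def x_def)
  have nz: "A + w * x \<noteq> 0" "A + s * x \<noteq> 0" "w \<noteq> 0" "w - s \<noteq> 0"
    using deriv_kernel_den_nonzero[OF lam _ z, of w] deriv_kernel_den_nonzero[OF lam s z] w by (auto simp: D)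
  define q where "q = (A + w * x) / (A + s * x) * (1 - s / w)"
  have "1 / q = w * (A + s * x) / ((A + w * x) * (w - s))"
    using nz by (simp add: q_def field_simps)
  also have "\<dots> = ((w + s) / (w - s) + (A - w * x) / (A + w * x)) / 2"
    using nz by (simp add: divide_simps) (simp add: algebra_simps)
  finally have *: "1 / q = ((w + s) / (w - s) + (A - w * x) / (A + w * x)) / 2" .
  have "Re (1 / q) = (Re ((w + s) / (w - s)) + Re ((A - w * x) / (A + w * x))) / 2"
    unfolding * Re_divide_numeral plus_complex.simps by simp
  moreover have "Re ((w + s) / (w - s)) \<ge> 0" using Re_Cayley_nonneg[of s w] s w by simp
  moreover have "Re ((A - w * x) / (A + w * x)) > 0"
    using Re_Cayley_pos[of "- (w * x)" A] xA by simp
  ultimately have "Re (1 / q) > 0" by simp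
  moreover have "Re (1 / q) = Re q / (norm q)\<^sup>2" by (simp add: Re_divide cmod_power2)
  ultimately have "Re q > 0" by (simp add: zero_less_divide_iff)
  then show ?thesis by (simp add: q_def D)
qed

text \<open>
  This is the convexity needed in \<open>convex_imp_starlike\<close> for \<open>m = 3\<close> and \<open>K = 1 / D\<^sup>2\<close>, where \<open>D\<close> is the
  denominator: \<open>3 + z K' / K\<close> equals \<open>(3 D - 2 z D') / D\<close>, whose numerator is the one below. The
  quotient is \<open>1 + 2 (1 + Z) / (1 + b - Z)\<close> with \<open>Z = w z\<^sup>2\<close> and \<open>b\<close> the linear term, and
  \<open>Re ((1 + b - Z) cnj (1 + Z))\<close> factors as \<open>(1 - \<bar>z\<bar>\<^sup>2) (1 + \<bar>z\<bar>\<^sup>2 + Re b)\<close>, which is positive because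
  \<open>\<bar>b\<bar> \<le> 2 \<bar>z\<bar>\<close>.
\<close>

lemma Re_convexity_factor_pos:
  assumes lam: "norm lam < 1" and w: "norm w = 1" and z: "norm z < 1"
  shows "Re ((3 + (cnj lam * w - lam) * z + w * z\<^sup>2) / deriv_kernel_den lam w z) > 0"
proof -
  define b Z where "b = (cnj lam * w - lam) * z" and "Z = w * z\<^sup>2"
  have D: "deriv_kernel_den lam w z = 1 + b - Z"
    by (simp add: deriv_kernel_den_def b_def Z_def algebra_simps power2_eq_square)
  have Dnz: "1 + b - Z \<noteq> 0"
    using deriv_kernel_den_nonzero[of lam w z] assms by (simp add: D)
  have nZ: "norm Z = (norm z)\<^sup>2" using w by (simp add: Z_def norm_mult norm_power)
  have nZ1: "norm Z < 1" unfolding nZ using z by (simp add: power_less_one_iff abs_square_less_1)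
  have Znz: "1 + Z \<noteq> 0"
    using nZ1 by (metis add_eq_0_iff norm_minus_cancel norm_one order_less_irrefl)
  have ww: "w * cnj w = 1" using w complex_norm_square[of w] by simp
  \<comment> \<open>The modulus of \<open>w\<close> being \<open>1\<close> makes the linear term reproduce its own conjugate.\<close>
  have sym: "b * cnj Z = - of_real ((norm z)\<^sup>2) * cnj b"
  proof -
    have "b * cnj Z = (cnj lam * (w * cnj w) - lam * cnj w) * (z * cnj z) * cnj z"
      by (simp add: b_def Z_def algebra_simps power2_eq_square)
    also have "\<dots> = - cnj b * (z * cnj z)"
      by (simp add: ww) (simp add: b_def algebra_simps)
    finally show ?thesis unfolding complex_norm_square by simp
  qed
  have "norm b \<le> 2 * norm z"
  proof -
    have "norm (cnj lam * w - lam) \<le> norm (cnj lam * w) + norm lam" by (rule norm_triangle_ineq4)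
    also have "\<dots> \<le> 2" using lam w by (simp add: norm_mult)
    finally show ?thesis by (simp add: b_def norm_mult mult_right_mono)
  qed
  then have "Re b \<ge> - 2 * norm z" using abs_Re_le_cmod[of b] by linarith
  then have "1 + (norm z)\<^sup>2 + Re b \<ge> (1 - norm z)\<^sup>2"
    by (simp add: power2_eq_square algebra_simps)
  moreover have "(1 - norm z)\<^sup>2 > 0" using z by simp
  ultimately have "1 + (norm z)\<^sup>2 + Re b > 0" by linarith
  moreover have "1 - (norm z)\<^sup>2 > 0" using z by (simp add: power_less_one_iff abs_square_less_1)
  ultimately have pos: "(1 - (norm z)\<^sup>2) * (1 + (norm z)\<^sup>2 + Re b) > 0" by simp
  have "Re ((1 + b - Z) * cnj (1 + Z)) = Re (1 - Z * cnj Z + b + b * cnj Z)"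
    by (simp add: algebra_simps)
  also have "\<dots> = (1 - (norm z)\<^sup>2) * (1 + (norm z)\<^sup>2 + Re b)"
    unfolding sym by (simp add: nZ algebra_simps power2_eq_square flip: complex_norm_square)
  finally have "Re ((1 + b - Z) * cnj (1 + Z)) > 0" using pos by simp
  then have "Re ((1 + Z) * cnj (1 + b - Z)) > 0"
    by (simp add: algebra_simps)
  then have "Re ((1 + Z) / (1 + b - Z)) > 0"
    using Dnz by (subst complex_div_cnj) (simp add: Re_divide_of_real
        del: of_real_power complex_cnj_diff complex_cnj_add flip: of_real_power)
  then have "Re (1 + of_real 2 * ((1 + Z) / (1 + b - Z))) > 0"
    by (simp only: plus_complex.simps times_complex.simps Re_complex_of_real Im_complex_of_real one_complex.simps)
  moreover have "(3 + b + Z) / (1 + b - Z) = 1 + of_real 2 * ((1 + Z) / (1 + b - Z))"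
    using Dnz by (simp add: field_simps)
  ultimately have "Re ((3 + b + Z) / (1 + b - Z)) > 0" by presburger
  then show ?thesis by (simp add: D b_def Z_def)
qed

lemma eq_if_same_derivative:
  assumes F: "\<And>z. z \<in> ball 0 1 \<Longrightarrow> (F has_field_derivative d z) (at z)"
    and G: "\<And>z. z \<in> ball 0 1 \<Longrightarrow> (G has_field_derivative d z) (at z)"
    and eq: "F 0 = G (0::complex)" and z: "z \<in> ball 0 1"
  shows "F z = (G z :: complex)"
proof -
  have "((\<lambda>z. F z - G z) has_field_derivative 0) (at x within ball 0 1)" if "x \<in> ball 0 1" for x
    using DERIV_diff[OF F[OF that] G[OF that]] has_field_derivative_at_within by fastforce
  then have "\<exists>c. \<forall>x\<in>ball 0 1. F x - G x = c"
    by (rule has_field_derivative_zero_constant[OF convex_ball])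
  then obtain c where c: "\<And>x. x \<in> ball 0 1 \<Longrightarrow> F x - G x = c" by blast
  show ?thesis using c[OF z] c[of 0] eq by simp
qed

lemma deriv_kernel_den_has_derivative:
  "(deriv_kernel_den lam w has_field_derivative (cnj lam * w - lam) - 2 * w * z) (at z)"
  unfolding deriv_kernel_den_def[abs_def]
  by (auto intro!: derivative_eq_intros simp: algebra_simps)

lemma deriv_kernel_den_holomorphic [holomorphic_intros]:
  "s holomorphic_on A \<Longrightarrow> (\<lambda>z. deriv_kernel_den lam (s z) z) holomorphic_on A"
  unfolding deriv_kernel_den_def by (intro holomorphic_intros)

lemma deriv_kernel_holomorphic:
  assumes "norm lam < 1" "norm w \<le> 1"
  shows "deriv_kernel lam w holomorphic_on ball 0 1"
  unfolding deriv_kernel_def[abs_def] using deriv_kernel_den_nonzero[OF assms]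
  by (intro holomorphic_intros) auto

lemma H_eq: "H \<beta> w lam z = z + 2 * (1 - of_real \<beta>) * contour_integral (linepath 0 z) (deriv_kernel lam w)"
  by (simp add: H_def deriv_kernel_def[abs_def] deriv_kernel_den_def)

lemma H_has_field_derivative:
  assumes "norm lam < 1" "norm w \<le> 1" and z: "z \<in> ball 0 1"
  shows "(H \<beta> w lam has_field_derivative 1 + 2 * (1 - of_real \<beta>) * deriv_kernel lam w z) (at z)"
proof -
  obtain F where F: "\<And>x. x \<in> ball 0 1 \<Longrightarrow> (F has_field_derivative deriv_kernel lam w x) (at x within ball 0 1)"
    by (rule holomorphic_convex_primitive'[OF convex_ball open_ball deriv_kernel_holomorphic[OF assms(1,2)]])
      iprover
  have eq: "x + 2 * (1 - of_real \<beta>) * (F x - F 0) = H \<beta> w lam x" if x: "x \<in> ball 0 1" for x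
  proof -
    have "path_image (linepath 0 x) \<subseteq> ball 0 1"
      using x by (simp add: closed_segment_subset)
    from contour_integral_primitive[OF F valid_path_linepath this]
    have "contour_integral (linepath 0 x) (deriv_kernel lam w) = F x - F 0"
      by (intro contour_integral_unique) simp
    then show ?thesis by (simp add: H_eq)
  qed
  have "(F has_field_derivative deriv_kernel lam w z) (at z)"
    using F[OF z] unfolding at_within_open[OF z open_ball] .
  then have "((\<lambda>x. x + 2 * (1 - of_real \<beta>) * (F x - F 0)) has_field_derivative
      1 + 2 * (1 - of_real \<beta>) * deriv_kernel lam w z) (at z)"
    by (auto intro!: derivative_eq_intros)
  then show ?thesis
    by (rule has_field_derivative_transform_within_open[OF _ open_ball z eq])
qed

lemma H_0 [simp]: "H \<beta> w lam 0 = 0"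
  by (simp add: H_eq)

lemma H_in_class:
  assumes \<beta>: "\<beta> < 1" and lam: "norm lam < 1" and w: "norm w \<le> 1"
  shows "H \<beta> w lam \<in> class_R_at \<beta> lam"
proof -
  note dH = H_has_field_derivative[OF lam w]
  have deriv_H: "deriv (H \<beta> w lam) z = 1 + 2 * (1 - of_real \<beta>) * deriv_kernel lam w z"
    if "z \<in> ball 0 1" for z
    using dH[OF that] by (rule DERIV_imp_deriv)
  have "H \<beta> w lam holomorphic_on ball 0 1"
    unfolding holomorphic_on_open[OF open_ball] using dH by blast
  moreover have "deriv (H \<beta> w lam) 0 = 1"
    using deriv_H[of 0] by (simp add: deriv_kernel_def)
  moreover have "Re (deriv (H \<beta> w lam) z) > \<beta>" if z: "z \<in> ball 0 1" for z
  proof -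
    have "Re (deriv_kernel lam w z) > - 1 / 2" using Re_deriv_kernel_gt[OF lam w] z by simp
    then have "2 * (1 - \<beta>) * Re (deriv_kernel lam w z) > 2 * (1 - \<beta>) * (- 1 / 2)"
      using \<beta> by (intro mult_strict_left_mono) auto
    also have "2 * (1 - \<beta>) * (- 1 / 2) = \<beta> - 1" by (simp add: field_simps)
    finally have "\<beta> < 1 + 2 * (1 - \<beta>) * Re (deriv_kernel lam w z)" by linarith
    also have "\<dots> = Re (deriv (H \<beta> w lam) z)" using deriv_H[OF z] by simp
    finally show ?thesis .
  qed
  moreover have "deriv (deriv (H \<beta> w lam)) 0 = 2 * (1 - of_real \<beta>) * lam"
  proof (rule DERIV_imp_deriv)
    have "deriv_kernel_den lam w 0 = 1" by (simp add: deriv_kernel_den_def)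
    then have "(deriv_kernel lam w has_field_derivative lam) (at 0)"
      unfolding deriv_kernel_def[abs_def]
      by (auto intro!: derivative_eq_intros deriv_kernel_den_has_derivative)
    then have "((\<lambda>z. 1 + 2 * (1 - of_real \<beta>) * deriv_kernel lam w z) has_field_derivative
        2 * (1 - of_real \<beta>) * lam) (at 0)"
      by (auto intro!: derivative_eq_intros)
    then show "(deriv (H \<beta> w lam) has_field_derivative 2 * (1 - of_real \<beta>) * lam) (at 0)"
      by (rule has_field_derivative_transform_within_open[OF _ open_ball[of 0 1]])
        (auto simp: deriv_H)
  qed
  ultimately show ?thesis
    by (simp add: class_R_at_def class_R_def class_A_def)
qed

text \<open>
  The Cayley transform \<open>F\<close> of \<open>f'\<close> is a Schwarz function with \<open>F'(0) = lam\<close>. Its quotient \<open>\<phi> = F / z\<close> takes the value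
  \<open>lam\<close> at \<open>0\<close>, so it is not a unimodular constant; moving this value to \<open>0\<close> by a Moebius map gives
  another Schwarz function \<open>\<psi>\<close>, and \<open>\<sigma> = \<psi> / z\<close>.
\<close>

lemma class_R_at_representation:
  assumes \<beta>: "\<beta> < 1" and lam: "norm lam < 1" and f: "f \<in> class_R_at \<beta> lam"
  obtains \<sigma> where "\<sigma> holomorphic_on ball 0 1"
    "(\<forall>z\<in>ball 0 1. norm (\<sigma> z) < 1) \<or> (\<exists>\<alpha>. norm \<alpha> = 1 \<and> (\<forall>z\<in>ball 0 1. \<sigma> z = \<alpha>))"
    "\<And>z. z \<in> ball 0 1 \<Longrightarrow> deriv f z = 1 + 2 * (1 - of_real \<beta>) * deriv_kernel lam (\<sigma> z) z"
proof -
  define m :: complex where "m = of_real (2 * (1 - \<beta>))"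
  have m: "m \<noteq> 0" "Re m = 2 * (1 - \<beta>)" "m = 2 * (1 - of_real \<beta>)"
    using \<beta> by (simp_all add: m_def)
  have holf: "f holomorphic_on ball 0 1" and f1: "deriv f 0 = 1"
    and pos: "\<And>z. z \<in> ball 0 1 \<Longrightarrow> Re (deriv f z) > \<beta>" and f2: "deriv (deriv f) 0 = m * lam"
    using f unfolding class_R_at_def class_R_def class_A_def m(3) by auto
  define p where "p z = deriv f z - 1" for z
  have p: "p holomorphic_on ball 0 1"
    unfolding p_def[abs_def] using holf by (intro holomorphic_intros) auto
  \<comment> \<open>\<open>Re p > - m / 2\<close> means that \<open>p\<close> is nearer to \<open>0\<close> than to \<open>- m\<close>.\<close>
  have less: "norm (p z) < norm (p z + m)" if "z \<in> ball 0 1" for z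
  proof -
    have "(norm (p z + m))\<^sup>2 - (norm (p z))\<^sup>2 = 4 * (1 - \<beta>) * (Re (deriv f z) - \<beta>)"
      unfolding cmod_power2 by (simp add: p_def m_def power2_eq_square algebra_simps)
    also have "\<dots> > 0" using \<beta> pos[OF that] by simp
    finally show ?thesis by (simp add: power2_less_imp_less)
  qed
  have nz: "p z + m \<noteq> 0" if "z \<in> ball 0 1" for z using less[OF that] by auto
  define F where "F z = p z / (p z + m)" for z
  have F: "F holomorphic_on ball 0 1"
    unfolding F_def[abs_def] using p nz by (intro holomorphic_intros) auto
  have F0: "F 0 = 0" by (simp add: F_def p_def f1)
  have Fbd: "norm (F z) < 1" if "norm z < 1" for z
    using less[of z] nz[of z] that by (simp add: F_def norm_divide)
  have "(deriv f has_field_derivative m * lam) (at 0)"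
    using holomorphic_derivI[OF holomorphic_deriv[OF holf open_ball] open_ball, of 0] f2 by simp
  then have "(p has_field_derivative m * lam) (at 0)"
    unfolding p_def[abs_def] by (auto intro!: derivative_eq_intros)
  then have "(F has_field_derivative
      (m * lam * (p 0 + m) - p 0 * (m * lam + 0)) / ((p 0 + m) * (p 0 + m))) (at 0)"
    unfolding F_def[abs_def] using nz[of 0] by (intro DERIV_divide DERIV_add DERIV_const) auto
  then have "(F has_field_derivative lam) (at 0)"
    using m(1) f1 by (simp add: p_def)
  then have F'0: "deriv F 0 = lam" by (rule DERIV_imp_deriv)
  obtain \<phi> where \<phi>: "\<phi> holomorphic_on ball 0 1" "\<And>z. norm z < 1 \<Longrightarrow> F z = z * \<phi> z"
    "\<phi> 0 = deriv F 0"
    "(\<forall>z\<in>ball 0 1. norm (\<phi> z) < 1) \<or> (\<exists>\<alpha>. norm \<alpha> = 1 \<and> (\<forall>z\<in>ball 0 1. \<phi> z = \<alpha>))"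
    by (rule Schwarz_quotient[OF F F0], erule Fbd) (rule that; assumption)
  have \<phi>0: "\<phi> 0 = lam" using \<phi>(3) F'0 by (rule trans)
  have \<phi>1: "norm (\<phi> z) < 1" if "norm z < 1" for z
    using \<phi>(4)
  proof
    assume "\<exists>\<alpha>. norm \<alpha> = 1 \<and> (\<forall>z\<in>ball 0 1. \<phi> z = \<alpha>)"
    then have "norm (\<phi> 0) = 1" by auto
    then show ?thesis using \<phi>0 lam by simp
  qed (use that in auto)
  \<comment> \<open>\<open>\<psi>\<close> is \<open>\<phi>\<close> followed by the disc automorphism that sends \<open>lam\<close> to \<open>0\<close>.\<close>
  define \<psi> where "\<psi> z = (\<phi> z - lam) / (1 - cnj lam * \<phi> z)" for z
  have Moeb: "norm (\<phi> z - lam) < norm (1 - cnj lam * \<phi> z)" if "norm z < 1" for z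
    using norm_add_less_Moebius[OF \<phi>1[OF that], of "- lam"] lam by simp
  have \<psi>nz: "1 - cnj lam * \<phi> z \<noteq> 0" if "norm z < 1" for z using Moeb[OF that] by auto
  have \<psi>: "\<psi> holomorphic_on ball 0 1"
    unfolding \<psi>_def[abs_def] using \<phi>(1) \<psi>nz by (intro holomorphic_intros) auto
  have \<psi>0: "\<psi> 0 = 0" by (simp add: \<psi>_def \<phi>0)
  have \<psi>1: "norm (\<psi> z) < 1" if "norm z < 1" for z
    using Moeb[OF that] \<psi>nz[OF that] by (simp add: \<psi>_def norm_divide)
  obtain \<sigma> where \<sigma>: "\<sigma> holomorphic_on ball 0 1" "\<And>z. norm z < 1 \<Longrightarrow> \<psi> z = z * \<sigma> z"
    "(\<forall>z\<in>ball 0 1. norm (\<sigma> z) < 1) \<or> (\<exists>\<alpha>. norm \<alpha> = 1 \<and> (\<forall>z\<in>ball 0 1. \<sigma> z = \<alpha>))"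
    by (rule Schwarz_quotient[OF \<psi> \<psi>0], erule \<psi>1) (rule that; assumption)
  have "deriv f z = 1 + 2 * (1 - of_real \<beta>) * deriv_kernel lam (\<sigma> z) z" if z: "z \<in> ball 0 1" for z
  proof -
    have z1: "norm z < 1" using z by simp
    have nzF: "1 - F z \<noteq> 0" using Fbd[OF z1] by auto
    have "norm (cnj lam * \<psi> z) < 1"
      using lam \<psi>1[OF z1] mult_strict_mono'[of "norm lam" 1 "norm (\<psi> z)" 1] by (simp add: norm_mult)
    then have nz\<psi>: "1 + cnj lam * \<psi> z \<noteq> 0"
      by (metis add_eq_0_iff norm_minus_cancel norm_one order_less_irrefl)
    have "\<phi> z * (1 + cnj lam * \<psi> z) = \<psi> z + lam"
    proof -
      have "\<psi> z * (1 - cnj lam * \<phi> z) = \<phi> z - lam" using \<psi>nz[OF z1] by (simp add: \<psi>_def)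
      then show ?thesis by (simp add: algebra_simps)
    qed
    then have \<phi>z: "\<phi> z = (\<psi> z + lam) / (1 + cnj lam * \<psi> z)"
      using nz\<psi> by (simp add: field_simps)
    have "p z = m * (F z / (1 - F z))"
    proof -
      have "F z * (p z + m) = p z" using nz[OF z] by (simp add: F_def)
      then have "p z * (1 - F z) = m * F z" by (simp add: algebra_simps)
      then show ?thesis using nzF by (simp add: field_simps)
    qed
    also have "F z / (1 - F z) = deriv_kernel lam (\<sigma> z) z"
    proof -
      have E: "F z = (\<psi> z + lam) * z / (1 + cnj lam * \<psi> z)"
        using \<phi>(2)[OF z1] \<phi>z by (simp add: mult.commute)
      have "F z / (1 - F z) = (\<psi> z + lam) * z / (1 + cnj lam * \<psi> z - (\<psi> z + lam) * z)"
        using nz\<psi> nzF unfolding E by (simp add: divide_simps)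
      then show ?thesis
        by (simp add: deriv_kernel_def deriv_kernel_den_def \<sigma>(2)[OF z1] mult.commute mult.left_commute)
    qed
    finally show ?thesis by (simp add: p_def m(3) diff_eq_eq add.commute)
  qed
  with \<sigma>(1,3) show thesis by (rule that)
qed

section \<open>Exposed points of the region of variability\<close>

text \<open>
  The direction \<open>e\<close> depends on \<open>w\<close>, \<open>lam\<close> and \<open>z\<^sub>0\<close> but not on \<open>f\<close>: it is \<open>w z\<^sub>0\<^sup>3 g(z\<^sub>0)\<close>, where \<open>z\<^sup>3 g\<close> is the
  primitive of \<open>z\<^sup>2 K\<close> vanishing at \<open>0\<close>, and \<open>(H z\<^sub>0 - f z\<^sub>0) / e\<close> is a positive multiple of the ratio of
  integrals \<open>n / g\<close>.
\<close>

lemma H_strictly_exposed: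
  assumes \<beta>: "\<beta> < 1" and lam: "norm lam < 1" and w: "norm w = 1"
    and z0: "z\<^sub>0 \<in> ball 0 1" "z\<^sub>0 \<noteq> 0"
  obtains e where "e \<noteq> 0"
    "\<And>f. f \<in> class_R_at \<beta> lam \<Longrightarrow>
       (\<forall>z\<in>ball 0 1. f z = H \<beta> w lam z) \<or> Re ((H \<beta> w lam z\<^sub>0 - f z\<^sub>0) / e) > 0"
proof -
  define D where "D = deriv_kernel_den lam w"
  have w1: "norm w \<le> 1" and w0: "w \<noteq> 0" using w by auto
  have D_nz: "D z \<noteq> 0" if "z \<in> ball 0 1" for z
    using deriv_kernel_den_nonzero[OF lam w1] that by (simp add: D_def)
  have D_hol: "D holomorphic_on ball 0 1"
    unfolding D_def by (rule deriv_kernel_den_holomorphic[OF holomorphic_on_const])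
  define K where "K z = 1 / (D z)\<^sup>2" for z
  have K_hol: "K holomorphic_on ball 0 1"
    unfolding K_def[abs_def] using D_hol D_nz by (intro holomorphic_intros) auto
  have K_nz: "K z \<noteq> 0" if "z \<in> ball 0 1" for z
    using D_nz[OF that] by (simp add: K_def)
  obtain g where g: "g holomorphic_on ball 0 1"
    "\<And>z. z \<in> ball 0 1 \<Longrightarrow> z * deriv g z + of_nat 3 * g z = K z"
    using Euler_equation_solvable[OF K_hol, of 2] by (auto simp: numeral_3_eq_3 numeral_2_eq_2)
  have conv: "Re (of_nat 3 + z * deriv K z / K z) > 0" if z: "z \<in> ball 0 1" for z
  proof -
    define D' where "D' = (cnj lam * w - lam) - 2 * w * z"
    have dD: "(D has_field_derivative D') (at z)"
      unfolding D_def D'_def by (rule deriv_kernel_den_has_derivative)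
    have "(K has_field_derivative (- 2 * D' / (D z) ^ 3)) (at z)"
      unfolding K_def[abs_def] using D_nz[OF z]
      by (auto intro!: derivative_eq_intros dD simp: field_simps power2_eq_square power3_eq_cube)
    then have "deriv K z = - 2 * D' / (D z) ^ 3" by (rule DERIV_imp_deriv)
    then have "of_nat 3 + z * deriv K z / K z = (3 * D z - 2 * z * D') / D z"
      using D_nz[OF z] by (simp add: K_def field_simps power2_eq_square power3_eq_cube)
    also have "3 * D z - 2 * z * D' = 3 + (cnj lam * w - lam) * z + w * z\<^sup>2"
      by (simp add: D_def D'_def deriv_kernel_den_def algebra_simps power2_eq_square)
    finally show ?thesis
      using Re_convexity_factor_pos[OF lam w, of z] z by (simp add: D_def)
  qed
  have star: "Re (g z / K z) > 0" if z: "z \<in> ball 0 1" for z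
    by (rule convex_imp_starlike[OF K_hol K_nz g(1) _ g(2) conv z]) auto
  have g_nz: "g z \<noteq> 0" if "z \<in> ball 0 1" for z using star[OF that] by auto
  show thesis
  proof (rule that[of "w * z\<^sub>0 ^ 3 * g z\<^sub>0"])
    show "w * z\<^sub>0 ^ 3 * g z\<^sub>0 \<noteq> 0" using w0 z0 g_nz by simp
  next
    fix f assume f: "f \<in> class_R_at \<beta> lam"
    note dH = H_has_field_derivative[where \<beta> = \<beta>, OF lam w1]
    have f_hol: "f holomorphic_on ball 0 1" and f0: "f 0 = 0"
      using f by (auto simp: class_R_at_def class_R_def class_A_def)
    note df = holomorphic_derivI[OF f_hol open_ball]
    obtain \<sigma> where \<sigma>: "\<sigma> holomorphic_on ball 0 1"
      "(\<forall>z\<in>ball 0 1. norm (\<sigma> z) < 1) \<or> (\<exists>\<alpha>. norm \<alpha> = 1 \<and> (\<forall>z\<in>ball 0 1. \<sigma> z = \<alpha>))"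
      "\<And>z. z \<in> ball 0 1 \<Longrightarrow> deriv f z = 1 + 2 * (1 - of_real \<beta>) * deriv_kernel lam (\<sigma> z) z"
      by (rule class_R_at_representation[OF \<beta> lam f]) (rule that; assumption)
    show "(\<forall>z\<in>ball 0 1. f z = H \<beta> w lam z) \<or> Re ((H \<beta> w lam z\<^sub>0 - f z\<^sub>0) / (w * z\<^sub>0 ^ 3 * g z\<^sub>0)) > 0"
    proof (cases "\<exists>z\<in>ball 0 1. \<sigma> z = w")
      case True
      then have \<sigma>w: "\<sigma> z = w" if "z \<in> ball 0 1" for z using \<sigma>(2) w that by fastforce
      have "f z = H \<beta> w lam z" if z: "z \<in> ball 0 1" for z
      proof (rule eq_if_same_derivative[OF df _ _ z])
        fix v :: complex assume v: "v \<in> ball 0 1"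
        show "(H \<beta> w lam has_field_derivative deriv f v) (at v)"
          using dH[OF v] unfolding \<sigma>(3)[OF v] \<sigma>w[OF v] .
      qed (simp_all add: f0)
      then show ?thesis by blast
    next
      case False
      have \<sigma>1: "norm (\<sigma> z) \<le> 1" if "z \<in> ball 0 1" for z using \<sigma>(2) that by fastforce
      define S where "S z = deriv_kernel_den lam (\<sigma> z) z" for z
      have S_nz: "S z \<noteq> 0" if "z \<in> ball 0 1" for z
        using deriv_kernel_den_nonzero[OF lam \<sigma>1[OF that]] that by (simp add: S_def)
      have S_hol: "S holomorphic_on ball 0 1"
        unfolding S_def[abs_def] using \<sigma>(1) by (rule deriv_kernel_den_holomorphic)
      define q where "q z = D z / S z * (1 - \<sigma> z / w)" for z
      have q_pos: "Re (q z) > 0" if z: "z \<in> ball 0 1" for z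
        unfolding q_def D_def S_def using False z
        by (intro Re_angle_factor_pos[OF lam \<sigma>1[OF z] w]) auto
      have "(\<lambda>z. K z * q z) holomorphic_on ball 0 1"
        unfolding q_def[abs_def] using K_hol D_hol S_hol S_nz \<sigma>(1) w0
        by (intro holomorphic_intros) auto
      from Euler_equation_solvable[OF this, of 2]
      obtain n where n: "n holomorphic_on ball 0 1"
        "\<And>z. z \<in> ball 0 1 \<Longrightarrow> z * deriv n z + of_nat 3 * n z = K z * q z"
        by (auto simp: numeral_3_eq_3 numeral_2_eq_2)
      have ratio: "Re (n z\<^sub>0 / g z\<^sub>0) > 0"
        by (rule Re_quotient_of_integrals_pos[OF g(1) n(1) _ g(2) n(2) star q_pos z0(1)]) auto
      define c where "c = 2 * (1 - \<beta>) * (1 - (norm lam)\<^sup>2)"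
      have c: "c > 0" using \<beta> lam by (simp add: c_def power_less_one_iff abs_square_less_1)
      have "H \<beta> w lam z\<^sub>0 - f z\<^sub>0 = of_real c * (w * z\<^sub>0 ^ 3 * n z\<^sub>0)"
      proof (rule eq_if_same_derivative[OF _ _ _ z0(1),
            of "\<lambda>z. H \<beta> w lam z - f z" _ "\<lambda>z. of_real c * (w * z ^ 3 * n z)"])
        fix z :: complex assume z: "z \<in> ball 0 1"
        have "((\<lambda>z. of_real c * (w * z ^ 3 * n z)) has_field_derivative
            of_real c * w * z\<^sup>2 * (z * deriv n z + of_nat 3 * n z)) (at z)"
          using holomorphic_derivI[OF n(1) open_ball z]
          by (auto intro!: derivative_eq_intros simp: algebra_simps power2_eq_square power3_eq_cube)
        then show "((\<lambda>z. of_real c * (w * z ^ 3 * n z)) has_field_derivative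
            of_real c * w * z\<^sup>2 * (K z * q z)) (at z)"
          unfolding n(2)[OF z] .
        have diff: "2 * (1 - of_real \<beta>) * (deriv_kernel lam w z - deriv_kernel lam (\<sigma> z) z)
            = of_real c * w * z\<^sup>2 * (K z * q z)"
        proof -
          have "deriv_kernel lam w z - deriv_kernel lam (\<sigma> z) z
             = of_real (1 - (norm lam)\<^sup>2) * (w - \<sigma> z) * z\<^sup>2 / (D z * S z)"
            unfolding D_def S_def using z by (intro deriv_kernel_diff[OF lam \<sigma>1[OF z] w1]) auto
          also have "\<dots> = of_real (1 - (norm lam)\<^sup>2) * ((w - \<sigma> z) * z\<^sup>2 / (D z * S z))"
            by (simp only: times_divide_eq_right mult.assoc)
          also have "(w - \<sigma> z) * z\<^sup>2 / (D z * S z) = w * z\<^sup>2 * (K z * q z)"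
            using D_nz[OF z] S_nz[OF z] w0
            by (simp add: K_def q_def field_simps power2_eq_square)
          finally show ?thesis by (simp add: c_def)
        qed
        show "((\<lambda>z. H \<beta> w lam z - f z) has_field_derivative
            of_real c * w * z\<^sup>2 * (K z * q z)) (at z)"
          using DERIV_diff[OF dH[OF z] df[OF z]]
          unfolding \<sigma>(3)[OF z] add_diff_cancel_left right_diff_distrib[symmetric] diff .
      qed (simp_all add: f0)
      then have "(H \<beta> w lam z\<^sub>0 - f z\<^sub>0) / (w * z\<^sub>0 ^ 3 * g z\<^sub>0) = of_real c * (n z\<^sub>0 / g z\<^sub>0)"
        using w0 z0 by simp
      then have "Re ((H \<beta> w lam z\<^sub>0 - f z\<^sub>0) / (w * z\<^sub>0 ^ 3 * g z\<^sub>0)) = c * Re (n z\<^sub>0 / g z\<^sub>0)"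
        by (simp only: times_complex.simps Re_complex_of_real Im_complex_of_real mult_zero_left
            diff_0_right)
      then show ?thesis using c ratio by simp
    qed
  qed
qed

text \<open>
  Evaluating the derivatives at any one point other than \<open>0\<close> suffices, since the kernel is an injective
  function of its parameter there; the proof uses \<open>1 / 2\<close>.
\<close>

lemma H_determines_parameter:
  assumes \<beta>: "\<beta> < 1" and lam: "norm lam < 1" and w: "norm w \<le> 1" "norm v \<le> 1"
    and eq: "\<And>z. z \<in> ball 0 1 \<Longrightarrow> H \<beta> w lam z = H \<beta> v lam z"
  shows "w = v"
proof -
  define z :: complex where "z = 1 / 2"
  have z: "z \<in> ball 0 1" "norm z < 1" "z \<noteq> 0" by (simp_all add: z_def norm_divide)
  have "(H \<beta> w lam has_field_derivative 1 + 2 * (1 - of_real \<beta>) * deriv_kernel lam v z) (at z)"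
    by (rule has_field_derivative_transform_within_open
        [OF H_has_field_derivative[OF lam w(2) z(1)] open_ball z(1)]) (simp add: eq)
  then have "1 + 2 * (1 - of_real \<beta>) * deriv_kernel lam v z = 1 + 2 * (1 - of_real \<beta>) * deriv_kernel lam w z"
    using H_has_field_derivative[OF lam w(1) z(1)] by (rule DERIV_unique)
  moreover have "1 - of_real \<beta> \<noteq> (0::complex)" using \<beta> by (simp add: complex_eq_iff)
  ultimately have "deriv_kernel lam w z - deriv_kernel lam v z = 0" by simp
  moreover have "1 - (norm lam)\<^sup>2 \<noteq> 0" using abs_square_less_1[of "norm lam"] lam by simp
  then have "complex_of_real (1 - (norm lam)\<^sup>2) \<noteq> 0" unfolding of_real_eq_0_iff .
  ultimately show "w = v"
    unfolding deriv_kernel_diff[OF lam w(2,1) z(2)]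
    using deriv_kernel_den_nonzero[OF lam w(1) z(2)] deriv_kernel_den_nonzero[OF lam w(2) z(2)] z(3)
    by (simp del: of_real_diff)
qed

lemma continuous_on_H_parameter:
  assumes lam: "norm lam < 1" and z: "norm z < 1"
  shows "continuous_on (cball 0 1) (\<lambda>w. H \<beta> w lam z)"
proof -
  have "continuous_on (cball 0 1 \<times> cbox 0 1) (\<lambda>(w, t::real). deriv_kernel lam w (of_real t * z) * z)"
    unfolding case_prod_unfold deriv_kernel_def deriv_kernel_den_def
  proof (intro continuous_intros ballI)
    fix x :: "complex \<times> real" assume x: "x \<in> cball 0 1 \<times> cbox 0 1"
    then have "norm (of_real (snd x) * z) < 1"
      using z mult_left_le_one_le[of "norm z" "snd x"] by (auto simp: norm_mult)
    then show "1 + cnj lam * fst x * (of_real (snd x) * z) -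
        (fst x * (of_real (snd x) * z) + lam) * (of_real (snd x) * z) \<noteq> 0"
      using deriv_kernel_den_nonzero[OF lam, of "fst x"] x by (auto simp: deriv_kernel_den_def)
  qed
  then have "continuous_on (cball 0 1) (\<lambda>w. integral (cbox 0 1) (\<lambda>t. deriv_kernel lam w (of_real t * z) * z))"
    by (rule integral_continuous_on_param)
  then show ?thesis
    unfolding H_eq contour_integral_integral
    by (intro continuous_intros) (simp add: linepath_def scaleR_conv_of_real)
qed

lemma convex_V_R: "convex (V_R \<beta> z\<^sub>0 lam)"
proof (rule convexI)
  fix x y and a b :: real
  assume xy: "x \<in> V_R \<beta> z\<^sub>0 lam" "y \<in> V_R \<beta> z\<^sub>0 lam" and ab: "0 \<le> a" "0 \<le> b" "a + b = 1"
  obtain f h where f: "f \<in> class_R_at \<beta> lam" "x = f z\<^sub>0" and h: "h \<in> class_R_at \<beta> lam" "y = h z\<^sub>0"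
    using xy by (auto simp: V_R_def)
  define k where "k z = of_real a * f z + of_real b * h z" for z
  have fh: "f holomorphic_on ball 0 1" "h holomorphic_on ball 0 1"
    using f h by (auto simp: class_R_at_def class_R_def class_A_def)
  have k: "k holomorphic_on ball 0 1"
    unfolding k_def[abs_def] using fh by (intro holomorphic_intros)
  have dk: "deriv k z = of_real a * deriv f z + of_real b * deriv h z" if z: "z \<in> ball 0 1" for z
    unfolding k_def[abs_def]
    using holomorphic_derivI[OF fh(1) open_ball z] holomorphic_derivI[OF fh(2) open_ball z]
    by (intro DERIV_imp_deriv derivative_eq_intros) auto
  have ddk: "deriv (deriv k) 0 = of_real a * deriv (deriv f) 0 + of_real b * deriv (deriv h) 0"
  proof (rule DERIV_imp_deriv)
    have "((\<lambda>z. of_real a * deriv f z + of_real b * deriv h z) has_field_derivative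
        of_real a * deriv (deriv f) 0 + of_real b * deriv (deriv h) 0) (at 0)"
      using holomorphic_derivI[OF holomorphic_deriv[OF fh(1) open_ball] open_ball, of 0]
        holomorphic_derivI[OF holomorphic_deriv[OF fh(2) open_ball] open_ball, of 0]
      by (intro DERIV_add DERIV_cmult) auto
    then show "(deriv k has_field_derivative
        of_real a * deriv (deriv f) 0 + of_real b * deriv (deriv h) 0) (at 0)"
      by (rule has_field_derivative_transform_within_open[OF _ open_ball[of 0 1]]) (auto simp: dk)
  qed
  have ab1: "of_real a + of_real b = (1::complex)" using ab by (metis of_real_1 of_real_add)
  have ab2: "of_real a * u + of_real b * u = u" for u :: complex
    using ab1 by (metis distrib_right mult_1)
  have "Re (deriv k z) > \<beta>" if z: "z \<in> ball 0 1" for z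
  proof -
    have "Re (deriv f z) > \<beta>" "Re (deriv h z) > \<beta>"
      using f h z by (auto simp: class_R_at_def class_R_def)
    then have "- Re (deriv f z) < - \<beta>" "- Re (deriv h z) < - \<beta>" by auto
    from convex_bound_lt[OF this ab] show ?thesis by (simp add: dk[OF z])
  qed
  moreover have "k 0 = 0" "deriv k 0 = 1" "deriv (deriv k) 0 = 2 * (1 - of_real \<beta>) * lam"
    using f h ab2 ab1 dk[of 0] ddk
    by (auto simp: k_def class_R_at_def class_R_def class_A_def)
  ultimately have "k \<in> class_R_at \<beta> lam"
    using k by (simp add: class_R_at_def class_R_def class_A_def)
  moreover have "a *\<^sub>R x + b *\<^sub>R y = k z\<^sub>0"
    by (simp add: k_def f h scaleR_conv_of_real)
  ultimately show "a *\<^sub>R x + b *\<^sub>R y \<in> V_R \<beta> z\<^sub>0 lam"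
    by (auto simp: V_R_def)
qed

lemma Re_functional_not_interior:
  fixes e p :: complex
  assumes e: "e \<noteq> 0" and le: "\<And>v. v \<in> V \<Longrightarrow> Re ((p - v) / e) \<ge> 0"
  shows "p \<notin> interior V"
proof
  assume "p \<in> interior V"
  then obtain r where r: "r > 0" "cball p r \<subseteq> V" by (auto simp: mem_interior_cball)
  define v where "v = p + of_real (r / norm e) * e"
  have "norm (v - p) = r" using r(1) e by (simp add: v_def norm_mult norm_divide)
  then have "v \<in> V" using r(2) by (auto simp: dist_norm norm_minus_commute)
  moreover have "(p - v) / e = - of_real (r / norm e)" using e by (simp add: v_def)
  then have "Re ((p - v) / e) = - (r / norm e)" by simp
  moreover have "r / norm e > 0" using r(1) e by simp
  ultimately show False using le[of v] by linarith
qed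

section \<open>The boundary curve\<close>

text \<open>
  The inside of the curve lies in the convex set \<open>V\<close>, hence in its interior. From such a point the
  half-open segment to any boundary point \<open>p\<close> stays in the interior of \<open>V\<close>; yet it leaves the inside
  of the curve, and it can only do so at \<open>p\<close>.
\<close>

lemma frontier_convex_eq_Jordan_curve:
  fixes V :: "complex set"
  assumes V: "convex V" and c: "simple_path c" "pathfinish c = pathstart c"
    and sub: "path_image c \<subseteq> V" and disj: "path_image c \<inter> interior V = {}"
  shows "frontier V = path_image c"
proof
  show "path_image c \<subseteq> frontier V"
    using sub disj closure_subset by (auto simp: frontier_def)
  show "frontier V \<subseteq> path_image c"
  proof
    fix p assume p: "p \<in> frontier V"
    note J = Jordan_inside_outside[OF c]
    have "inside (path_image c) \<subseteq> V"
      using outside_subset_convex[OF V sub] J by blast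
    then have ins: "inside (path_image c) \<subseteq> interior V"
      using J by (simp add: interior_maximal)
    obtain a where a: "a \<in> inside (path_image c)" using J by blast
    show "p \<in> path_image c"
    proof (rule ccontr)
      assume np: "p \<notin> path_image c"
      have "p \<notin> inside (path_image c)" using ins p by (auto simp: frontier_def)
      then have "closed_segment a p \<inter> frontier (inside (path_image c)) \<noteq> {}"
        using a by (intro connected_Int_frontier) auto
      moreover have "frontier (inside (path_image c)) \<subseteq> path_image c"
        using c by (intro frontier_inside_subset closed_simple_path_image)
      ultimately obtain x where x: "x \<in> closed_segment a p" "x \<in> path_image c" by blast
      have "open_segment a p \<subseteq> interior V"
        using V a ins p by (intro in_interior_closure_convex_segment) (auto simp: frontier_def)
      moreover have "x \<noteq> a" "x \<noteq> p" using x np a disj ins by auto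
      ultimately have "x \<in> interior V" using x(1) by (auto simp: open_segment_def)
      then show False using x(2) disj by blast
    qed
  qed
qed

theorem corollary6p1:
  fixes \<beta> :: real and lam z\<^sub>0 :: complex
  assumes "0 \<le> \<beta>" and "\<beta> < 1"
    and "lam \<in> ball 0 1"
    and "z\<^sub>0 \<in> ball 0 1 - {0}"
  shows "Jordan_param (\<lambda>\<theta>. H \<beta> (cis \<theta>) lam z\<^sub>0) \<and>
         frontier (V_R \<beta> z\<^sub>0 lam) = (\<lambda>\<theta>. H \<beta> (cis \<theta>) lam z\<^sub>0) ` {- pi<..pi} \<and>
         (\<forall>f \<in> class_R_at \<beta> lam. \<forall>\<theta> \<in> {- pi<..pi}.
            f z\<^sub>0 = H \<beta> (cis \<theta>) lam z\<^sub>0 \<longrightarrow> (\<forall>z \<in> ball 0 1. f z = H \<beta> (cis \<theta>) lam z))"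
proof -
  have lam: "norm lam < 1" and z0: "z\<^sub>0 \<in> ball 0 1" "z\<^sub>0 \<noteq> 0" "norm z\<^sub>0 < 1"
    using assms by auto
  note \<beta> = \<open>\<beta> < 1\<close>
  define c where "c \<theta> = H \<beta> (cis \<theta>) lam z\<^sub>0" for \<theta>
  have unique: "\<forall>z \<in> ball 0 1. f z = H \<beta> w lam z"
    if f: "f \<in> class_R_at \<beta> lam" and w: "norm w = 1" and eq: "f z\<^sub>0 = H \<beta> w lam z\<^sub>0" for f w
  proof -
    obtain e where e: "e \<noteq> 0"
      "\<And>f. f \<in> class_R_at \<beta> lam \<Longrightarrow>
         (\<forall>z\<in>ball 0 1. f z = H \<beta> w lam z) \<or> Re ((H \<beta> w lam z\<^sub>0 - f z\<^sub>0) / e) > 0"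
      by (rule H_strictly_exposed[OF \<beta> lam w z0(1,2)]) (rule that; assumption)
    show ?thesis using e(2)[OF f] eq by simp
  qed
  have c_eqD: "cis \<theta> = cis \<eta>" if "c \<theta> = c \<eta>" for \<theta> \<eta>
  proof (rule H_determines_parameter[OF \<beta> lam])
    have "\<forall>z \<in> ball 0 1. H \<beta> (cis \<theta>) lam z = H \<beta> (cis \<eta>) lam z"
      using that by (intro unique H_in_class[OF \<beta> lam]) (auto simp: c_def)
    then show "H \<beta> (cis \<theta>) lam z = H \<beta> (cis \<eta>) lam z" if "z \<in> ball 0 1" for z
      using that by blast
  qed auto
  have inj: "inj_on c {- pi<..pi}"
    by (rule inj_onI) (metis c_eqD Arg_cis)
  have c_V: "c \<theta> \<in> V_R \<beta> z\<^sub>0 lam" for \<theta>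
    unfolding c_def V_R_def using H_in_class[OF \<beta> lam, of "cis \<theta>"] by auto
  have c_int: "c \<theta> \<notin> interior (V_R \<beta> z\<^sub>0 lam)" for \<theta>
  proof -
    obtain e where e: "e \<noteq> 0"
      "\<And>f. f \<in> class_R_at \<beta> lam \<Longrightarrow>
         (\<forall>z\<in>ball 0 1. f z = H \<beta> (cis \<theta>) lam z) \<or> Re ((H \<beta> (cis \<theta>) lam z\<^sub>0 - f z\<^sub>0) / e) > 0"
      by (rule H_strictly_exposed[OF \<beta> lam norm_cis z0(1,2)]) (rule that; assumption)
    show ?thesis
    proof (rule Re_functional_not_interior[OF e(1)])
      fix v assume "v \<in> V_R \<beta> z\<^sub>0 lam"
      then obtain f where "f \<in> class_R_at \<beta> lam" "v = f z\<^sub>0" by (auto simp: V_R_def)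
      then show "Re ((c \<theta> - v) / e) \<ge> 0" using e(2)[of f] z0(1) by (auto simp: c_def)
    qed
  qed
  define \<gamma> where "\<gamma> = c \<circ> linepath (- pi) pi"
  have lp: "linepath (- pi) pi t = (2 * t - 1) * pi" for t
    by (simp add: linepath_def algebra_simps)
  have "continuous_on UNIV c"
    unfolding c_def[abs_def]
    by (rule continuous_on_compose2[OF continuous_on_H_parameter[OF lam z0(3)]])
      (auto intro!: continuous_intros)
  then have "path \<gamma>"
    unfolding \<gamma>_def path_def
    by (rule continuous_on_compose[OF continuous_on_linepath continuous_on_subset]) auto
  have "cis (- pi) = cis pi" by (simp add: complex_eq_iff)
  then have c_pi: "c (- pi) = c pi" by (simp add: c_def)
  have loop: "pathfinish \<gamma> = pathstart \<gamma>"
    by (simp add: \<gamma>_def pathfinish_compose pathstart_compose c_pi)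
  have range: "(2 * t - 1) * pi \<in> {- pi<..pi}" if "0 < t" "t \<le> 1" for t
  proof -
    have "(2 * t - 1) * pi = 2 * (t * pi) - pi" by (simp add: algebra_simps)
    moreover have "0 < t * pi" "t * pi \<le> pi" using that by auto
    ultimately show ?thesis by simp
  qed
  have "loop_free \<gamma>"
    unfolding loop_free_def
  proof (intro ballI impI)
    \<comment> \<open>The curve is injective on \<open>(0, 1]\<close>, and the value at \<open>0\<close> recurs only at \<open>1\<close>.\<close>
    have key: "s = t \<or> s = 0 \<and> t = 1" if st: "s \<in> {0..1}" "t \<in> {0..1}" "s \<le> t" "\<gamma> s = \<gamma> t" for s t
    proof (cases "s = 0")
      case False
      then have "(2 * s - 1) * pi \<in> {- pi<..pi}" "(2 * t - 1) * pi \<in> {- pi<..pi}"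
        using st by (auto intro!: range simp del: greaterThanAtMost_iff)
      then have "(2 * s - 1) * pi = (2 * t - 1) * pi"
        using st(4) by (intro inj_onD[OF inj]) (simp_all add: \<gamma>_def lp)
      then show ?thesis by simp
    next
      case s: True
      show ?thesis
      proof (cases "t = 0")
        case False
        then have "(2 * t - 1) * pi \<in> {- pi<..pi}" "pi \<in> {- pi<..pi}"
          using st range[of t] by auto
        moreover have "c ((2 * t - 1) * pi) = c pi" using st(4) s c_pi by (simp add: \<gamma>_def lp)
        ultimately have "(2 * t - 1) * pi = pi" using inj_onD[OF inj] by blast
        then show ?thesis using s by simp
      qed (use s in auto)
    qed
    fix s t assume "s \<in> {0..1}" "t \<in> {0..1}" "\<gamma> s = \<gamma> t"
    then show "s = t \<or> s = 0 \<and> t = 1 \<or> s = 1 \<and> t = 0"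
      using key[of s t] key[of t s] by (metis linear)
  qed
  with \<open>path \<gamma>\<close> have simple: "simple_path \<gamma>" by (simp add: simple_path_def)
  have image: "path_image \<gamma> = c ` {- pi<..pi}"
  proof -
    have "path_image \<gamma> = c ` {- pi..pi}"
      unfolding \<gamma>_def path_image_compose path_image_linepath
      by (simp add: closed_segment_eq_real_ivl)
    also have "{- pi..pi} = insert (- pi) {- pi<..pi}" by auto
    also have "c ` \<dots> = c ` {- pi<..pi}" using c_pi by (auto simp: image_iff)
    finally show ?thesis .
  qed
  have "frontier (V_R \<beta> z\<^sub>0 lam) = path_image \<gamma>"
    by (rule frontier_convex_eq_Jordan_curve[OF convex_V_R simple loop])
      (use c_V c_int in \<open>auto simp: image\<close>)
  then have "frontier (V_R \<beta> z\<^sub>0 lam) = c ` {- pi<..pi}" by (simp add: image)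
  moreover have "Jordan_param c"
    using simple loop by (simp add: Jordan_param_def \<gamma>_def)
  moreover have "\<forall>f \<in> class_R_at \<beta> lam. \<forall>\<theta> \<in> {- pi<..pi}.
      f z\<^sub>0 = c \<theta> \<longrightarrow> (\<forall>z \<in> ball 0 1. f z = H \<beta> (cis \<theta>) lam z)"
    unfolding c_def using unique[OF _ norm_cis] by blast
  ultimately show ?thesis
    unfolding c_def[abs_def] by (intro conjI)
qed

end
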